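(* Let $(L,[\cdot,\cdot,\cdot],\alpha)$ be a regular 3-Hom-Lie algebra, let $(V;\rho,\beta)$ be a regular representation of it, and let $T:V\to L$ be an embedding tensor on $(L,[\cdot,\cdot,\cdot],\alpha)$ with respect to $(V;\rho,\beta)$. Let $T^1_t=T+t\mathfrak{I}_1$ and $T^2_t=T+t\mathfrak{I}_2$ be two linear deformations of $T$. If $T^1_t$ and $T^2_t$ are equivalent, then $\mathfrak{I}_1$ and $\mathfrak{I}_2$ define the same cohomology class in $\mathcal{H}^1_T(V,L)$.
   Context: All vector spaces are over a field $\mathbb{K}$ of characteristic $0$. A 3-Hom-Lie algebra $(L,[\cdot,\cdot,\cdot],\alpha)$ is a vector space $L$ with a trilinear skew-symmetric map $[\cdot,\cdot,\cdot]:L\times L\times L\to L$ and a linear map $\alpha:L\to L$ such that $\alpha([x,y,z])=[\alpha(x),\alpha(y),\alpha(z)]$ and $$[\alpha(a),\alpha(b),[x,y,z]]=[[a,b,x],\alpha(y),\alpha(z)]+[\alpha(x),[a,b,y],\alpha(z)]+[\alpha(x),\alpha(y),[a,b,z]]$$ for all $a,b,x,y,z\in L$. It is regular if $\alpha$ is a vector space automorphism. A homomorphism of 3-Hom-Lie algebras is a linear map preserving the brackets and commuting with the structure maps $\alpha$. A representation $(V;\rho,\beta)$ of $(L,[\cdot,\cdot,\cdot],\alpha)$ is a vector space $V$ with $\beta\in\mathrm{End}(V)$ and a skew-symmetric linear map $\rho:\wedge^2L\to\mathrm{End}(V)$ such that for all $x,y,a,b\in L$: $$\rho(\alpha(x),\alpha(y))\circ\beta=\beta\circ\rho(x,y),$$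 $$\rho(\alpha(x),\alpha(y))\rho(a,b)-\rho(\alpha(a),\alpha(b))\rho(x,y)=(\rho([x,y,a],\alpha(b))-\rho([x,y,b],\alpha(a)))\circ\beta,$$ $$\rho([x,y,a],\alpha(b))\circ\beta-\rho(\alpha(y),\alpha(a))\rho(x,b)=\rho(\alpha(a),\alpha(x))\rho(y,b)+\rho(\alpha(x),\alpha(y))\rho(a,b).$$ It is regular if $\beta$ is a vector space automorphism. Write $\mathrm{ad}(x,y)z=[x,y,z]$. An embedding tensor on $L$ with respect to $(V;\rho,\beta)$ is a linear map $T:V\to L$ with $T\circ\beta=\alpha\circ T$ and $[Tu,Tv,Tw]=T(\rho(Tu,Tv)w)$ for all $u,v,w\in V$. A homomorphism from an embedding tensor $T'$ to an embedding tensor $T$ (both with respect to $(V;\rho,\beta)$) is a pair $(\psi_L,\psi_V)$ of a 3-Hom-Lie algebra homomorphism $\psi_L:L\to L$ and a linear map $\psi_V:V\to V$ such that $\beta\circ\psi_V=\psi_V\circ\beta$, $T\circ\psi_V=\psi_L\circ T'$, and $\psi_V(\rho(x,y)u)=\rho(\psi_L(x),\psi_L(y))\psi_V(u)$ for all $x,y\in L$, $u\in V$. A linear deformation of $T$ is a family $T_t=T+t\mathfrak{I}$, with $\mathfrak{I}:V\to L$ linear, such that $T_t$ is an embedding tensor on $L$ with respect to $(V;\rho,\beta)$ for all $t\in\mathbb{K}$. Two linear deformations $T^1_t=T+t\mathfrak{I}_1$ and $T^2_t=T+t\mathfrak{I}_2$ are equivalent if there exist $a,b\in L$ with $\alpha(a)=a$,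 $\alpha(b)=b$ such that, for all $t$, the pair $(\mathrm{Id}_L+t\,\alpha^{-1}\circ\mathrm{ad}(a,b),\ \mathrm{Id}_V+t\,\beta^{-1}\circ\rho(a,b))$ is a homomorphism from $T^2_t$ to $T^1_t$. Cohomology of $T$ in degree 1: $\mathcal{C}^1_T(V,L)=\{f\in\mathrm{Hom}(V,L): \alpha\circ f=f\circ\beta\}$. For $f\in\mathcal{C}^1_T(V,L)$ and $u,v,w\in V$, $$(\delta_Tf)(u,v,w)=-f(\rho(Tu,Tv)w)+[Tu,Tv,f(w)]+[Tu,f(v),Tw]-T\rho(Tu,f(v))w+[f(u),Tv,Tw]-T\rho(f(u),Tv)w.$$ $\mathcal{Z}^1_T(V,L)=\{f\in \mathcal{C}^1_T(V,L):\delta_Tf=0\}$. $\mathcal{C}^0_T(V,L)$ is the subspace of $\wedge^2L$ spanned by the elements $a\wedge b$ with $\alpha(a)=a$, $\alpha(b)=b$, and $\delta_T:\mathcal{C}^0_T(V,L)\to\mathcal{C}^1_T(V,L)$ is the linear map sending $a\wedge b$ to $\wp(a,b)$, where $\wp(a,b)v=T\rho(a,b)\beta^{-1}(v)-[a,b,T\beta^{-1}(v)]$ for $v\in V$. $\mathcal{B}^1_T(V,L)=\delta_T(\mathcal{C}^0_T(V,L))$ and $\mathcal{H}^1_T(V,L)=\mathcal{Z}^1_T(V,L)/\mathcal{B}^1_T(V,L)$. For every linear deformation $T+t\mathfrak{I}$ of $T$ one has $\mathfrak{I}\in\mathcal{Z}^1_T(V,L)$. *)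

theory Defs
  imports Complex_Main "HOL-Library.Function_Algebras"
begin

text \<open>
  Vector spaces are the type-based ones of \<^theory>\<open>HOL.Vector_Spaces\<close>: an abelian group type
  together with a scalar multiplication. Spaces of maps carry the pointwise group operations
  of \<^theory>\<open>HOL-Library.Function_Algebras\<close> and the following scalar multiplication.
\<close>

definition fun_scale :: "('k \<Rightarrow> 'b \<Rightarrow> 'b) \<Rightarrow> 'k \<Rightarrow> ('a \<Rightarrow> 'b) \<Rightarrow> 'a \<Rightarrow> 'b" where
  "fun_scale s c f = (\<lambda>x. s c (f x))"

lemma vector_space_fun_scale:
  assumes "vector_space s"
  shows "vector_space (fun_scale s)"
proof -
  interpret vector_space s by fact
  show ?thesis
    by unfold_locales
      (simp_all add: fun_scale_def fun_eq_iff scale_right_distrib scale_left_distrib)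
qed

lemma vector_space_mult: "vector_space ((*) :: 'k::field \<Rightarrow> 'k \<Rightarrow> 'k)"
  by unfold_locales (simp_all add: algebra_simps)


section \<open>Regular 3-Hom-Lie algebras, representations, embedding tensors\<close>

record ('k, 'l) hom_lie3 =
  lscale :: "'k \<Rightarrow> 'l \<Rightarrow> 'l"
  bracket :: "'l \<Rightarrow> 'l \<Rightarrow> 'l \<Rightarrow> 'l"
  twist :: "'l \<Rightarrow> 'l"

locale hom_lie3_algebra =
  fixes L :: "('k::field_char_0, 'l::ab_group_add) hom_lie3"
  assumes vector_space_L: "vector_space (lscale L)"
    and bracket_linear1: "Vector_Spaces.linear (lscale L) (lscale L) (\<lambda>x. bracket L x y z)"
    and bracket_linear2: "Vector_Spaces.linear (lscale L) (lscale L) (\<lambda>y. bracket L x y z)"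
    and bracket_linear3: "Vector_Spaces.linear (lscale L) (lscale L) (\<lambda>z. bracket L x y z)"
    and bracket_skew12: "bracket L y x z = - bracket L x y z"
    and bracket_skew23: "bracket L x z y = - bracket L x y z"
    and twist_linear: "Vector_Spaces.linear (lscale L) (lscale L) (twist L)"
    and twist_bracket:
      "twist L (bracket L x y z) = bracket L (twist L x) (twist L y) (twist L z)"
    and hom_jacobi:
      "bracket L (twist L a) (twist L b) (bracket L x y z) =
         bracket L (bracket L a b x) (twist L y) (twist L z)
       + bracket L (twist L x) (bracket L a b y) (twist L z)
       + bracket L (twist L x) (twist L y) (bracket L a b z)"

definition regular_hom_lie3_algebra :: "('k::field_char_0, 'l::ab_group_add) hom_lie3 \<Rightarrow> bool" where
  "regular_hom_lie3_algebra L \<longleftrightarrow> hom_lie3_algebra L \<and> bij (twist L)"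

definition hom_lie3_hom ::
    "('k::field_char_0, 'l::ab_group_add) hom_lie3 \<Rightarrow> ('k, 'm::ab_group_add) hom_lie3 \<Rightarrow> ('l \<Rightarrow> 'm) \<Rightarrow> bool" where
  "hom_lie3_hom L M \<psi> \<longleftrightarrow>
     Vector_Spaces.linear (lscale L) (lscale M) \<psi> \<and>
     (\<forall>x y z. \<psi> (bracket L x y z) = bracket M (\<psi> x) (\<psi> y) (\<psi> z)) \<and>
     (\<forall>x. \<psi> (twist L x) = twist M (\<psi> x))"

record ('k, 'l, 'v) hom_rep =
  vscale :: "'k \<Rightarrow> 'v \<Rightarrow> 'v"
  action :: "'l \<Rightarrow> 'l \<Rightarrow> 'v \<Rightarrow> 'v"
  vtwist :: "'v \<Rightarrow> 'v"

text \<open>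
  A linear map from the exterior square of \<open>L\<close> to the endomorphisms of \<open>V\<close> is given as a
  skew-symmetric bilinear map on \<open>L\<close>.
\<close>

locale hom_lie3_representation = hom_lie3_algebra L
  for L :: "('k::field_char_0, 'l::ab_group_add) hom_lie3" +
  fixes V :: "('k, 'l, 'v::ab_group_add) hom_rep"
  assumes vector_space_V: "vector_space (vscale V)"
    and vtwist_linear: "Vector_Spaces.linear (vscale V) (vscale V) (vtwist V)"
    and action_endo: "Vector_Spaces.linear (vscale V) (vscale V) (action V x y)"
    and action_linear1: "Vector_Spaces.linear (lscale L) (vscale V) (\<lambda>x. action V x y v)"
    and action_linear2: "Vector_Spaces.linear (lscale L) (vscale V) (\<lambda>y. action V x y v)"
    and action_skew: "action V y x v = - action V x y v"
    and action_vtwist: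
      "action V (twist L x) (twist L y) \<circ> vtwist V = vtwist V \<circ> action V x y"
    and action_commutator:
      "action V (twist L x) (twist L y) (action V a b v)
         - action V (twist L a) (twist L b) (action V x y v) =
       action V (bracket L x y a) (twist L b) (vtwist V v)
         - action V (bracket L x y b) (twist L a) (vtwist V v)"
    and action_bracket:
      "action V (bracket L x y a) (twist L b) (vtwist V v)
         - action V (twist L y) (twist L a) (action V x b v) =
       action V (twist L a) (twist L x) (action V y b v)
         + action V (twist L x) (twist L y) (action V a b v)"

definition regular_hom_lie3_representation ::
    "('k::field_char_0, 'l::ab_group_add) hom_lie3 \<Rightarrow> ('k, 'l, 'v::ab_group_add) hom_rep \<Rightarrow> bool" where
  "regular_hom_lie3_representation L V \<longleftrightarrow> hom_lie3_representation L V \<and> bij (vtwist V)"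

definition embedding_tensor ::
    "('k::field_char_0, 'l::ab_group_add) hom_lie3 \<Rightarrow> ('k, 'l, 'v::ab_group_add) hom_rep \<Rightarrow> ('v \<Rightarrow> 'l) \<Rightarrow> bool" where
  "embedding_tensor L V T \<longleftrightarrow>
     Vector_Spaces.linear (vscale V) (lscale L) T \<and>
     T \<circ> vtwist V = twist L \<circ> T \<and>
     (\<forall>u v w. bracket L (T u) (T v) (T w) = T (action V (T u) (T v) w))"

text \<open>Homomorphisms from \<open>T'\<close> to \<open>T\<close>.\<close>

definition embedding_tensor_hom ::
    "('k::field_char_0, 'l::ab_group_add) hom_lie3 \<Rightarrow> ('k, 'l, 'v::ab_group_add) hom_rep \<Rightarrow>
     ('v \<Rightarrow> 'l) \<Rightarrow> ('v \<Rightarrow> 'l) \<Rightarrow> ('l \<Rightarrow> 'l) \<Rightarrow> ('v \<Rightarrow> 'v) \<Rightarrow> bool" where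
  "embedding_tensor_hom L V T' T \<psi>L \<psi>V \<longleftrightarrow>
     hom_lie3_hom L L \<psi>L \<and>
     Vector_Spaces.linear (vscale V) (vscale V) \<psi>V \<and>
     vtwist V \<circ> \<psi>V = \<psi>V \<circ> vtwist V \<and>
     T \<circ> \<psi>V = \<psi>L \<circ> T' \<and>
     (\<forall>x y u. \<psi>V (action V x y u) = action V (\<psi>L x) (\<psi>L y) (\<psi>V u))"


section \<open>Linear deformations\<close>

definition deform ::
    "('k::field_char_0, 'l::ab_group_add) hom_lie3 \<Rightarrow> ('v \<Rightarrow> 'l) \<Rightarrow> ('v \<Rightarrow> 'l) \<Rightarrow> 'k \<Rightarrow> 'v \<Rightarrow> 'l" where
  "deform L T \<II> t = (\<lambda>v. T v + lscale L t (\<II> v))"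

definition linear_deformation ::
    "('k::field_char_0, 'l::ab_group_add) hom_lie3 \<Rightarrow> ('k, 'l, 'v::ab_group_add) hom_rep \<Rightarrow>
     ('v \<Rightarrow> 'l) \<Rightarrow> ('v \<Rightarrow> 'l) \<Rightarrow> bool" where
  "linear_deformation L V T \<II> \<longleftrightarrow>
     Vector_Spaces.linear (vscale V) (lscale L) \<II> \<and>
     (\<forall>t. embedding_tensor L V (deform L T \<II> t))"

text \<open>Note the direction: the homomorphisms go from the second family to the first.\<close>

definition equivalent_deformations ::
    "('k::field_char_0, 'l::ab_group_add) hom_lie3 \<Rightarrow> ('k, 'l, 'v::ab_group_add) hom_rep \<Rightarrow>
     ('k \<Rightarrow> 'v \<Rightarrow> 'l) \<Rightarrow> ('k \<Rightarrow> 'v \<Rightarrow> 'l) \<Rightarrow> bool" where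
  "equivalent_deformations L V T1 T2 \<longleftrightarrow>
     (\<exists>a b. twist L a = a \<and> twist L b = b \<and>
        (\<forall>t. embedding_tensor_hom L V (T2 t) (T1 t)
               (\<lambda>x. x + lscale L t (inv (twist L) (bracket L a b x)))
               (\<lambda>u. u + vscale V t (inv (vtwist V) (action V a b u)))))"


section \<open>The exterior square\<close>

definition alternating_bilinear ::
    "('k::field \<Rightarrow> 'l::ab_group_add \<Rightarrow> 'l) \<Rightarrow> ('k \<Rightarrow> 'w::ab_group_add \<Rightarrow> 'w) \<Rightarrow> ('l \<Rightarrow> 'l \<Rightarrow> 'w) \<Rightarrow> bool" where
  "alternating_bilinear s s' B \<longleftrightarrow>
     (\<forall>y. Vector_Spaces.linear s s' (\<lambda>x. B x y)) \<and>
     (\<forall>x. Vector_Spaces.linear s s' (B x)) \<and>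
     (\<forall>x. B x x = 0)"

text \<open>
  The exterior square is realised inside the dual of the space of alternating bilinear forms,
  \<open>a \<and> b\<close> being evaluation at \<open>(a, b)\<close>; the value away from alternating forms is a dummy. The
  lemmas \<open>alternating_bilinear_wedge\<close> and \<open>ext_square_universal\<close> show that this has the
  universal property of the exterior square.
\<close>

type_synonym ('k, 'l) bivector = "('l \<Rightarrow> 'l \<Rightarrow> 'k) \<Rightarrow> 'k"

definition wedge ::
    "('k::field_char_0, 'l::ab_group_add) hom_lie3 \<Rightarrow> 'l \<Rightarrow> 'l \<Rightarrow> ('k, 'l) bivector" where
  "wedge L a b = (\<lambda>\<phi>. if alternating_bilinear (lscale L) (*) \<phi> then \<phi> a b else 0)"

abbreviation bivector_scale :: "'k::field \<Rightarrow> ('k, 'l) bivector \<Rightarrow> ('k, 'l) bivector" where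
  "bivector_scale \<equiv> fun_scale (*)"

definition ext_square ::
    "('k::field_char_0, 'l::ab_group_add) hom_lie3 \<Rightarrow> ('k, 'l) bivector set" where
  "ext_square L = module.span bivector_scale {wedge L a b |a b. True}"

lemma alternating_bilinear_wedge:
  fixes L :: "('k::field_char_0, 'l::ab_group_add) hom_lie3"
  assumes "vector_space (lscale L)"
  shows "alternating_bilinear (lscale L) bivector_scale (wedge L)"
proof -
  have E: "vector_space (bivector_scale :: 'k \<Rightarrow> ('k, 'l) bivector \<Rightarrow> _)"
    by (rule vector_space_fun_scale[OF vector_space_mult])
  have lin: "f (x + y) = f x + f y" "f (lscale L c x) = c * f x"
    if "Vector_Spaces.linear (lscale L) (*) f" for f :: "'l \<Rightarrow> 'k" and x y c
    using that by (simp_all add: Vector_Spaces.linear_iff)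
  have "Vector_Spaces.linear (lscale L) bivector_scale (\<lambda>x. wedge L x y)" for y
    unfolding Vector_Spaces.linear_iff
  proof (intro conjI allI assms E ext)
    fix u v c and \<phi> :: "'l \<Rightarrow> 'l \<Rightarrow> 'k"
    have "Vector_Spaces.linear (lscale L) (*) (\<lambda>x. \<phi> x y)" if "alternating_bilinear (lscale L) (*) \<phi>"
      using that by (simp add: alternating_bilinear_def)
    note l = lin[OF this]
    show "wedge L (u + v) y \<phi> = (wedge L u y + wedge L v y) \<phi>"
      using l(1) by (simp add: wedge_def)
    show "wedge L (lscale L c u) y \<phi> = bivector_scale c (wedge L u y) \<phi>"
      using l(2) by (simp add: wedge_def fun_scale_def)
  qed
  moreover have "Vector_Spaces.linear (lscale L) bivector_scale (wedge L x)" for x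
    unfolding Vector_Spaces.linear_iff
  proof (intro conjI allI assms E ext)
    fix u v c and \<phi> :: "'l \<Rightarrow> 'l \<Rightarrow> 'k"
    have "Vector_Spaces.linear (lscale L) (*) (\<phi> x)" if "alternating_bilinear (lscale L) (*) \<phi>"
      using that by (simp add: alternating_bilinear_def)
    note l = lin[OF this]
    show "wedge L x (u + v) \<phi> = (wedge L x u + wedge L x v) \<phi>"
      using l(1) by (simp add: wedge_def)
    show "wedge L x (lscale L c u) \<phi> = bivector_scale c (wedge L x u) \<phi>"
      using l(2) by (simp add: wedge_def fun_scale_def)
  qed
  moreover have "wedge L x x = 0" for x
    by (rule ext) (simp add: wedge_def alternating_bilinear_def)
  ultimately show ?thesis by (simp add: alternating_bilinear_def)
qed

lemma separating_functional:
  fixes s :: "'k::field \<Rightarrow> 'w::ab_group_add \<Rightarrow> 'w"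
  assumes "vector_space s" and "w \<noteq> 0"
  obtains f where "Vector_Spaces.linear s (*) f" and "f w \<noteq> 0"
proof -
  interpret W: vector_space s by fact
  interpret P: vector_space_pair s "(*) :: 'k \<Rightarrow> 'k \<Rightarrow> 'k"
    by (simp add: vector_space_pair_def assms vector_space_mult)
  have "W.independent {w}" using assms(2) by simp
  from P.linear_independent_extend[OF this, of "\<lambda>_. 1"]
  obtain f where "Vector_Spaces.linear s (*) f" "f w = 1" by auto
  then show thesis using that by simp
qed

lemma linear_fun_sum:
  assumes "Vector_Spaces.linear s s' f"
  shows "f (\<Sum>i\<in>A. s (c i) (x i)) = (\<Sum>i\<in>A. s' (c i) (f (x i)))"
proof -
  interpret Vector_Spaces.linear s s' f by fact
  show ?thesis by (simp add: sum scale)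
qed

lemma alternating_bilinear_compose:
  assumes "Vector_Spaces.linear s' s'' f" "alternating_bilinear s s' B"
  shows "alternating_bilinear s s'' (\<lambda>a b. f (B a b))"
proof -
  interpret f: Vector_Spaces.linear s' s'' f by fact
  have "vector_space s''" by (rule f.vs2.vector_space_axioms)
  with assms(2) show ?thesis
    unfolding alternating_bilinear_def Vector_Spaces.linear_iff
    by (simp add: f.add f.scale f.zero)
qed

lemma ext_square_universal:
  fixes L :: "('k::field_char_0, 'l::ab_group_add) hom_lie3"
    and s :: "'k \<Rightarrow> 'w::ab_group_add \<Rightarrow> 'w"
  assumes L: "vector_space (lscale L)" and W: "vector_space s"
    and B: "alternating_bilinear (lscale L) s B"
  obtains g where "Vector_Spaces.linear bivector_scale s g" and "\<And>a b. g (wedge L a b) = B a b"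
proof -
  let ?sc = "bivector_scale :: 'k \<Rightarrow> ('k, 'l) bivector \<Rightarrow> _"
  interpret E: vector_space ?sc by (rule vector_space_fun_scale[OF vector_space_mult])
  interpret W: vector_space s by fact
  interpret P: vector_space_pair ?sc s
    by (rule vector_space_pair.intro) (rule E.vector_space_axioms W)+
  let ?S = "{wedge L a b |a b. True}"
  obtain S where S: "S \<subseteq> ?S" "E.independent S" "?S \<subseteq> E.span S"
    by (rule E.maximal_independent_subset[of ?S])
  have "\<forall>x\<in>S. \<exists>p. x = wedge L (fst p) (snd p)" using S(1) by fastforce
  then obtain p where p: "\<And>x. x \<in> S \<Longrightarrow> x = wedge L (fst (p x)) (snd (p x))" by metis
  obtain g where g: "Vector_Spaces.linear ?sc s g"
    "\<And>x. x \<in> S \<Longrightarrow> g x = B (fst (p x)) (snd (p x))"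
    using P.linear_independent_extend[OF S(2), of "\<lambda>x. B (fst (p x)) (snd (p x))"] by auto
  have "g (wedge L a b) = B a b" for a b
  proof -
    have "wedge L a b \<in> E.span S" using S(3) by blast
    then obtain t r where t: "finite t" "t \<subseteq> S" "wedge L a b = (\<Sum>x\<in>t. ?sc (r x) x)"
      unfolding E.span_explicit by blast
    let ?d = "B a b - (\<Sum>x\<in>t. s (r x) (B (fst (p x)) (snd (p x))))"
    have "?d = 0"
    proof (rule ccontr)
      assume "?d \<noteq> 0"
      then obtain f where f: "Vector_Spaces.linear s (*) f" "f ?d \<noteq> 0"
        using separating_functional[OF W] by blast
      interpret f: Vector_Spaces.linear s "(*)" f by (rule f(1))
      let ?\<phi> = "\<lambda>a b. f (B a b)"
      have alt: "alternating_bilinear (lscale L) (*) ?\<phi>"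
        by (rule alternating_bilinear_compose[OF f(1) B])
      have ev: "(\<Sum>x\<in>A. ?sc (r x) x) ?\<phi> = (\<Sum>x\<in>A. r x * x ?\<phi>)" if "finite A" for A
        using that by (induction A) (simp_all add: fun_scale_def)
      have "f (B a b) = wedge L a b ?\<phi>" using alt by (simp add: wedge_def)
      also have "\<dots> = (\<Sum>x\<in>t. r x * x ?\<phi>)" unfolding t(3) by (rule ev[OF t(1)])
      also have "\<dots> = (\<Sum>x\<in>t. r x * f (B (fst (p x)) (snd (p x))))"
      proof (rule sum.cong[OF refl])
        fix x assume "x \<in> t"
        then have "x = wedge L (fst (p x)) (snd (p x))" using t(2) p by blast
        then have "x ?\<phi> = wedge L (fst (p x)) (snd (p x)) ?\<phi>" by (rule arg_cong)
        then show "r x * x ?\<phi> = r x * f (B (fst (p x)) (snd (p x)))"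
          using alt by (simp add: wedge_def)
      qed
      finally have "f ?d = 0" by (simp add: f.diff f.sum f.scale)
      with f(2) show False by simp
    qed
    moreover have "g (wedge L a b) = (\<Sum>x\<in>t. s (r x) (B (fst (p x)) (snd (p x))))"
      unfolding t(3) linear_fun_sum[OF g(1)] using t(2) g(2) by (intro sum.cong) auto
    ultimately show ?thesis by simp
  qed
  with g(1) show thesis using that by blast
qed


section \<open>Cohomology of an embedding tensor in degree 1\<close>

abbreviation hom_scale ::
    "('k::field_char_0, 'l::ab_group_add) hom_lie3 \<Rightarrow> 'k \<Rightarrow> ('v \<Rightarrow> 'l) \<Rightarrow> 'v \<Rightarrow> 'l" where
  "hom_scale L \<equiv> fun_scale (lscale L)"

definition cochains1 ::
    "('k::field_char_0, 'l::ab_group_add) hom_lie3 \<Rightarrow> ('k, 'l, 'v::ab_group_add) hom_rep \<Rightarrow> ('v \<Rightarrow> 'l) set" where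
  "cochains1 L V = {f. Vector_Spaces.linear (vscale V) (lscale L) f \<and> twist L \<circ> f = f \<circ> vtwist V}"

definition delta1 ::
    "('k::field_char_0, 'l::ab_group_add) hom_lie3 \<Rightarrow> ('k, 'l, 'v::ab_group_add) hom_rep \<Rightarrow>
     ('v \<Rightarrow> 'l) \<Rightarrow> ('v \<Rightarrow> 'l) \<Rightarrow> 'v \<Rightarrow> 'v \<Rightarrow> 'v \<Rightarrow> 'l" where
  "delta1 L V T f = (\<lambda>u v w.
     - f (action V (T u) (T v) w)
     + bracket L (T u) (T v) (f w)
     + bracket L (T u) (f v) (T w) - T (action V (T u) (f v) w)
     + bracket L (f u) (T v) (T w) - T (action V (f u) (T v) w))"

definition cocycles1 ::
    "('k::field_char_0, 'l::ab_group_add) hom_lie3 \<Rightarrow> ('k, 'l, 'v::ab_group_add) hom_rep \<Rightarrow>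
     ('v \<Rightarrow> 'l) \<Rightarrow> ('v \<Rightarrow> 'l) set" where
  "cocycles1 L V T = {f \<in> cochains1 L V. \<forall>u v w. delta1 L V T f u v w = 0}"

definition cochains0 ::
    "('k::field_char_0, 'l::ab_group_add) hom_lie3 \<Rightarrow> ('k, 'l) bivector set" where
  "cochains0 L = module.span bivector_scale {wedge L a b |a b. twist L a = a \<and> twist L b = b}"

lemma cochains0_subset:
  fixes L :: "('k::field_char_0, 'l::ab_group_add) hom_lie3"
  shows "cochains0 L \<subseteq> ext_square L"
proof -
  interpret E: vector_space "bivector_scale :: 'k \<Rightarrow> ('k, 'l) bivector \<Rightarrow> _"
    by (rule vector_space_fun_scale[OF vector_space_mult])
  show ?thesis unfolding cochains0_def ext_square_def by (rule E.span_mono) blast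
qed

definition wp ::
    "('k::field_char_0, 'l::ab_group_add) hom_lie3 \<Rightarrow> ('k, 'l, 'v::ab_group_add) hom_rep \<Rightarrow>
     ('v \<Rightarrow> 'l) \<Rightarrow> 'l \<Rightarrow> 'l \<Rightarrow> 'v \<Rightarrow> 'l" where
  "wp L V T a b = (\<lambda>v. T (action V a b (inv (vtwist V) v)) - bracket L a b (T (inv (vtwist V) v)))"

text \<open>
  The differential in degree 0 is the linear map with \<open>a \<and> b \<mapsto> wp a b\<close> for twist-fixed \<open>a\<close>, \<open>b\<close>.
  Only its values on \<^const>\<open>cochains0\<close> matter, and there it is uniquely determined; that such a
  map exists is \<open>delta0_exists\<close> below.
\<close>

definition is_delta0 ::
    "('k::field_char_0, 'l::ab_group_add) hom_lie3 \<Rightarrow> ('k, 'l, 'v::ab_group_add) hom_rep \<Rightarrow>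
     ('v \<Rightarrow> 'l) \<Rightarrow> (('k, 'l) bivector \<Rightarrow> 'v \<Rightarrow> 'l) \<Rightarrow> bool" where
  "is_delta0 L V T D \<longleftrightarrow>
     Vector_Spaces.linear bivector_scale (hom_scale L) D \<and>
     (\<forall>a b. twist L a = a \<longrightarrow> twist L b = b \<longrightarrow> D (wedge L a b) = wp L V T a b)"

definition delta0 ::
    "('k::field_char_0, 'l::ab_group_add) hom_lie3 \<Rightarrow> ('k, 'l, 'v::ab_group_add) hom_rep \<Rightarrow>
     ('v \<Rightarrow> 'l) \<Rightarrow> ('k, 'l) bivector \<Rightarrow> 'v \<Rightarrow> 'l" where
  "delta0 L V T = (SOME D. is_delta0 L V T D)"

definition coboundaries1 ::
    "('k::field_char_0, 'l::ab_group_add) hom_lie3 \<Rightarrow> ('k, 'l, 'v::ab_group_add) hom_rep \<Rightarrow>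
     ('v \<Rightarrow> 'l) \<Rightarrow> ('v \<Rightarrow> 'l) set" where
  "coboundaries1 L V T = delta0 L V T ` cochains0 L"

text \<open>Classes are the cosets of the coboundaries; the first cohomology is the quotient space.\<close>

definition cohomology_class ::
    "('k::field_char_0, 'l::ab_group_add) hom_lie3 \<Rightarrow> ('k, 'l, 'v::ab_group_add) hom_rep \<Rightarrow>
     ('v \<Rightarrow> 'l) \<Rightarrow> ('v \<Rightarrow> 'l) \<Rightarrow> ('v \<Rightarrow> 'l) set" where
  "cohomology_class L V T f = {f + b |b. b \<in> coboundaries1 L V T}"

definition cohomology1 ::
    "('k::field_char_0, 'l::ab_group_add) hom_lie3 \<Rightarrow> ('k, 'l, 'v::ab_group_add) hom_rep \<Rightarrow>
     ('v \<Rightarrow> 'l) \<Rightarrow> ('v \<Rightarrow> 'l) set set" where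
  "cohomology1 L V T = cohomology_class L V T ` cocycles1 L V T"

lemma delta0_exists:
  fixes L :: "('k::field_char_0, 'l::ab_group_add) hom_lie3"
    and V :: "('k, 'l, 'v::ab_group_add) hom_rep"
  assumes LV: "hom_lie3_representation L V" and T: "Vector_Spaces.linear (vscale V) (lscale L) T"
  shows "is_delta0 L V T (delta0 L V T)"
proof -
  interpret hom_lie3_representation L V by fact
  interpret VL: vector_space "lscale L" by (rule vector_space_L)
  have H: "vector_space (hom_scale L :: 'k \<Rightarrow> ('v \<Rightarrow> 'l) \<Rightarrow> 'v \<Rightarrow> 'l)"
    by (rule vector_space_fun_scale[OF vector_space_L])
  note sums = bracket_linear1[unfolded Vector_Spaces.linear_iff]
    bracket_linear2[unfolded Vector_Spaces.linear_iff]
    action_linear1[unfolded Vector_Spaces.linear_iff]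
    action_linear2[unfolded Vector_Spaces.linear_iff]
    T[unfolded Vector_Spaces.linear_iff]
  have self: "x = 0" if "x = - x" for x :: 'l
  proof -
    have "lscale L 2 x = x + x" using VL.scale_left_distrib[of 1 1 x] by simp
    also have "\<dots> = 0" by (subst (2) that) simp
    finally show ?thesis by simp
  qed
  have skew: "wp L V T x y = - wp L V T y x" for x y
  proof -
    interpret T: Vector_Spaces.linear "vscale V" "lscale L" T by fact
    show ?thesis
      by (rule ext)
        (simp add: wp_def bracket_skew12[of x y] action_skew[of x y] T.neg)
  qed
  have "wp L V T x x = 0" for x
    using skew[of x x] self by (auto simp: fun_eq_iff)
  moreover have "Vector_Spaces.linear (lscale L) (hom_scale L) (\<lambda>x. wp L V T x z)" for z
    unfolding Vector_Spaces.linear_iff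
    by (intro conjI allI vector_space_L H ext)
      (simp_all add: wp_def fun_scale_def sums VL.scale_right_diff_distrib)
  moreover have "Vector_Spaces.linear (lscale L) (hom_scale L) (wp L V T z)" for z
    unfolding Vector_Spaces.linear_iff
    by (intro conjI allI vector_space_L H ext)
      (simp_all add: wp_def fun_scale_def sums VL.scale_right_diff_distrib)
  ultimately have "alternating_bilinear (lscale L) (hom_scale L) (wp L V T)"
    by (simp add: alternating_bilinear_def)
  from ext_square_universal[OF vector_space_L vector_space_fun_scale[OF vector_space_L] this]
  obtain g where "is_delta0 L V T g" by (metis is_delta0_def)
  then show ?thesis unfolding delta0_def by (rule someI[of "is_delta0 L V T"])
qed

end

theory Submission
  imports Defs
begin

text \<open>
  Comparing the coefficients of \<open>t\<close> on both sides of the embedding tensor equation for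
  \<open>T + t \<II>\<close> shows that \<open>\<II>\<close> is a cocycle. Comparing them in
  \<open>T\<^sup>1\<^sub>t \<circ> \<psi>\<^sub>V = \<psi>\<^sub>L \<circ> T\<^sup>2\<^sub>t\<close> gives
  \<open>\<II>\<^sub>2 - \<II>\<^sub>1 = T \<circ> \<beta>\<^sup>-\<^sup>1 \<circ> \<rho>(a, b) - \<alpha>\<^sup>-\<^sup>1 \<circ> ad(a, b) \<circ> T\<close>; since \<open>a\<close> and \<open>b\<close> are fixed by \<open>\<alpha>\<close>,
  the inverse twists can be moved to the right, and the difference is \<open>\<delta>\<^sub>T(a \<and> b)\<close>.
\<close>

text \<open>Three values of \<open>t\<close> suffice: \<open>t = 1\<close> eliminates
  \<open>z\<close>, \<open>t = -1\<close> then gives \<open>2 y = 0\<close>, and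
  \<open>t = 2\<close> leaves \<open>-6 x = 0\<close>. Characteristic 0 makes 2 and 6
  invertible.\<close>

lemma cubic_linear_coeff_zero:
  fixes s :: "'k::field_char_0 \<Rightarrow> 'w::ab_group_add \<Rightarrow> 'w"
  assumes "vector_space s"
    and eq: "\<And>t. s t x + s (t * t) y + s (t * t * t) z = 0"
  shows "x = 0"
proof -
  interpret vector_space s by fact
  have two: "s 2 v = v + v" for v using scale_left_distrib[of 1 1 v] by simp
  have z: "z = - (x + y)" using eq[of 1] by (simp only: eq_neg_iff_add_eq_0 mult_1_left scale_one ac_simps)
  have "s 2 y = 0" using eq[of "-1"] by (simp add: z two)
  then have y: "y = 0" by simp
  have "s 2 x - s 8 x = 0" using eq[of 2] by (simp add: z y)
  then have "s (2 - 8) x = 0" by (simp only: scale_left_diff_distrib)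
  then show ?thesis by simp
qed

lemma quadratic_linear_coeff_eq:
  fixes s :: "'k::field_char_0 \<Rightarrow> 'w::ab_group_add \<Rightarrow> 'w"
  assumes "vector_space s"
    and eq: "\<And>t. s t x + s (t * t) y = s t x' + s (t * t) y'"
  shows "x = x'"
proof -
  interpret vector_space s by fact
  have "s t (x - x') + s (t * t) (y - y') + s (t * t * t) 0 = 0" for t
    using eq[of t] by (simp add: scale_right_diff_distrib algebra_simps)
  then have "x - x' = 0" by (rule cubic_linear_coeff_zero[OF assms(1)])
  then show ?thesis by simp
qed

lemma linear_deformation_cocycle:
  assumes rep: "hom_lie3_representation L V"
    and T: "embedding_tensor L V T"
    and D: "linear_deformation L V T \<II>"
  shows "\<II> \<in> cocycles1 L V T"
proof -
  interpret hom_lie3_representation L V by fact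
  interpret VL: vector_space "lscale L" by (rule vector_space_L)
  interpret tw: Vector_Spaces.linear "lscale L" "lscale L" "twist L" by (rule twist_linear)
  from T have T_lin: "Vector_Spaces.linear (vscale V) (lscale L) T"
    and T_twist: "\<And>v. T (vtwist V v) = twist L (T v)"
    and T_br: "\<And>u v w. bracket L (T u) (T v) (T w) = T (action V (T u) (T v) w)"
    by (auto simp: embedding_tensor_def fun_eq_iff)
  from D have I_lin: "Vector_Spaces.linear (vscale V) (lscale L) \<II>"
    and D_twist: "\<And>t v. deform L T \<II> t (vtwist V v) = twist L (deform L T \<II> t v)"
    and D_br: "\<And>t u v w. bracket L (deform L T \<II> t u) (deform L T \<II> t v) (deform L T \<II> t w) =
        deform L T \<II> t (action V (deform L T \<II> t u) (deform L T \<II> t v) w)"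
    by (auto simp: linear_deformation_def embedding_tensor_def fun_eq_iff)
  note linears = bracket_linear1[unfolded Vector_Spaces.linear_iff]
    bracket_linear2[unfolded Vector_Spaces.linear_iff]
    bracket_linear3[unfolded Vector_Spaces.linear_iff]
    action_linear1[unfolded Vector_Spaces.linear_iff]
    action_linear2[unfolded Vector_Spaces.linear_iff]
    T_lin[unfolded Vector_Spaces.linear_iff]
    I_lin[unfolded Vector_Spaces.linear_iff]
  \<comment> \<open>At \<open>t = 1\<close> the deformed map is \<open>T + \<II>\<close>; cancelling
    the same relation for \<open>T\<close> leaves the one for \<open>\<II>\<close>.\<close>
  have "\<II> (vtwist V v) = twist L (\<II> v)" for v
    using D_twist[of 1 v] by (simp add: deform_def T_twist tw.add)
  then have "\<II> \<in> cochains1 L V" by (simp add: cochains1_def I_lin fun_eq_iff)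
  moreover have "delta1 L V T \<II> u v w = 0" for u v w
  proof -
    let ?A = "action V" and ?B = "bracket L"
    \<comment> \<open>\<open>y\<close> and \<open>z\<close> are the coefficients of
      \<open>t^2\<close> and \<open>t^3\<close> in the defect of the embedding tensor equation for
      \<open>T + t \<II>\<close>. The coefficient of \<open>t\<close> is \<open>delta1\<close>, and
      the constant one vanishes by \<open>T_br\<close>.\<close>
    define y where "y = ?B (\<II> u) (\<II> v) (T w) + ?B (\<II> u) (T v) (\<II> w) + ?B (T u) (\<II> v) (\<II> w)
        - T (?A (\<II> u) (\<II> v) w) - \<II> (?A (\<II> u) (T v) w) - \<II> (?A (T u) (\<II> v) w)"
    define z where "z = ?B (\<II> u) (\<II> v) (\<II> w) - \<II> (?A (\<II> u) (\<II> v) w)"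
    have "lscale L t (delta1 L V T \<II> u v w) + lscale L (t * t) y + lscale L (t * t * t) z = 0" for t
    proof -
      have "lscale L t (delta1 L V T \<II> u v w) + lscale L (t * t) y + lscale L (t * t * t) z
        = ?B (deform L T \<II> t u) (deform L T \<II> t v) (deform L T \<II> t w)
          - deform L T \<II> t (?A (deform L T \<II> t u) (deform L T \<II> t v) w)"
        by (simp add: deform_def delta1_def y_def z_def linears T_br
            VL.scale_right_distrib VL.scale_right_diff_distrib algebra_simps)
      also have "\<dots> = 0" using D_br by simp
      finally show ?thesis .
    qed
    then show ?thesis by (rule cubic_linear_coeff_zero[OF vector_space_L])
  qed
  ultimately show ?thesis by (simp add: cocycles1_def)
qed

text \<open>The homomorphisms run from the second family to the first, which is why
  \<open>wp\<close> enters with a plus sign on the side of \<open>\<II>\<^sub>1\<close>.\<close>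

lemma equivalent_deformations_diff_wp:
  assumes reg: "regular_hom_lie3_algebra L" "regular_hom_lie3_representation L V"
    and T: "embedding_tensor L V T"
    and I1: "Vector_Spaces.linear (vscale V) (lscale L) \<II>\<^sub>1"
    and equiv: "equivalent_deformations L V (deform L T \<II>\<^sub>1) (deform L T \<II>\<^sub>2)"
  obtains a b where "twist L a = a" "twist L b = b" "\<II>\<^sub>2 = \<II>\<^sub>1 + wp L V T a b"
proof -
  interpret hom_lie3_representation L V
    using reg(2) by (simp add: regular_hom_lie3_representation_def)
  interpret VL: vector_space "lscale L" by (rule vector_space_L)
  have bij_L: "bij (twist L)" and bij_V: "bij (vtwist V)"
    using reg by (simp_all add: regular_hom_lie3_algebra_def regular_hom_lie3_representation_def)
  from T have T_lin: "Vector_Spaces.linear (vscale V) (lscale L) T"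
    and T_twist: "\<And>v. T (vtwist V v) = twist L (T v)"
    by (auto simp: embedding_tensor_def fun_eq_iff)
  note T_lin' = T_lin[unfolded Vector_Spaces.linear_iff]
  note I1_lin' = I1[unfolded Vector_Spaces.linear_iff]
  interpret tw: Vector_Spaces.linear "lscale L" "lscale L" "twist L" by (rule twist_linear)
  obtain a b where ab: "twist L a = a" "twist L b = b"
    and hom: "\<And>t. embedding_tensor_hom L V (deform L T \<II>\<^sub>2 t) (deform L T \<II>\<^sub>1 t)
       (\<lambda>x. x + lscale L t (inv (twist L) (bracket L a b x)))
       (\<lambda>u. u + vscale V t (inv (vtwist V) (action V a b u)))"
    using equiv by (auto simp: equivalent_deformations_def)
  let ?P = "\<lambda>x. inv (twist L) (bracket L a b x)"
  let ?R = "\<lambda>u. inv (vtwist V) (action V a b u)"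
  note inv_L = inv_f_eq[OF bij_is_inj[OF bij_L]] bij_inv_eq_iff[OF bij_L, THEN iffD1, OF refl]
  note inv_V = inv_f_eq[OF bij_is_inj[OF bij_V]] bij_inv_eq_iff[OF bij_V, THEN iffD1, OF refl]
  \<comment> \<open>As \<open>a\<close> and \<open>b\<close> are fixed, \<open>twist_bracket\<close>
    says that \<open>bracket L a b\<close> commutes with \<open>twist L\<close>, hence with its
    inverse. The same argument with \<open>action_vtwist\<close> gives \<open>R_eq\<close>.\<close>
  have P_eq: "?P x = bracket L a b (inv (twist L) x)" for x
    by (rule inv_L(1)) (simp add: twist_bracket ab inv_L(2))
  have "vtwist V (action V a b v) = action V a b (vtwist V v)" for v
    using action_vtwist[of a b] ab by (simp add: fun_eq_iff)
  then have R_eq: "?R u = action V a b (inv (vtwist V) u)" for u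
    by (intro inv_V(1)) (simp add: inv_V(2))
  have T_inv: "T (inv (vtwist V) v) = inv (twist L) (T v)" for v
    by (rule inv_L(1)[symmetric]) (simp add: T_twist[symmetric] inv_V(2))
  have inv_lin: "inv (twist L) (x + y) = inv (twist L) x + inv (twist L) y"
    "inv (twist L) (lscale L c x) = lscale L c (inv (twist L) x)" for x y c
    by (rule inv_L(1), simp add: tw.add tw.scale inv_L(2))+
  note br3 = bracket_linear3[unfolded Vector_Spaces.linear_iff]
  have "\<II>\<^sub>2 v = \<II>\<^sub>1 v + wp L V T a b v" for v
  proof -
    \<comment> \<open>This is the intertwining relation evaluated at \<open>v\<close>, with the
      common constant term \<open>T v\<close> cancelled.\<close>
    have "lscale L t (\<II>\<^sub>1 v + T (?R v)) + lscale L (t * t) (\<II>\<^sub>1 (?R v)) =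
      lscale L t (\<II>\<^sub>2 v + ?P (T v)) + lscale L (t * t) (?P (\<II>\<^sub>2 v))" for t
    proof -
      have "deform L T \<II>\<^sub>1 t (v + vscale V t (?R v)) =
        deform L T \<II>\<^sub>2 t v + lscale L t (?P (deform L T \<II>\<^sub>2 t v))"
        using hom[of t] by (simp add: embedding_tensor_hom_def fun_eq_iff)
      then show ?thesis
        by (simp add: deform_def T_lin' I1_lin' br3 inv_lin VL.scale_right_distrib algebra_simps)
    qed
    then have "\<II>\<^sub>1 v + T (?R v) = \<II>\<^sub>2 v + ?P (T v)"
      by (rule quadratic_linear_coeff_eq[OF vector_space_L])
    \<comment> \<open>\<open>T_inv\<close> turns \<open>bracket L a b (inv (twist L) (T v))\<close>
      into the second term of \<open>wp\<close>.\<close>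
    then show ?thesis by (simp add: wp_def R_eq P_eq T_inv algebra_simps)
  qed
  then show thesis using that ab by (simp add: fun_eq_iff)
qed

text \<open>\<open>delta0\<close> is a choice, so its value on \<open>wedge L a b\<close> is known
  only through \<open>delta0_exists\<close>; the fixed points \<open>a\<close> and \<open>b\<close>
  make this bivector a generator of \<open>cochains0 L\<close>.\<close>

lemma wp_coboundary:
  fixes L :: "('k::field_char_0, 'l::ab_group_add) hom_lie3"
  assumes "hom_lie3_representation L V" "Vector_Spaces.linear (vscale V) (lscale L) T"
    and "twist L a = a" "twist L b = b"
  shows "wp L V T a b \<in> coboundaries1 L V T"
proof -
  interpret E: vector_space "bivector_scale :: 'k \<Rightarrow> ('k, 'l) bivector \<Rightarrow> _"
    by (rule vector_space_fun_scale[OF vector_space_mult])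
  have "delta0 L V T (wedge L a b) = wp L V T a b"
    using delta0_exists[OF assms(1,2)] assms(3,4) by (simp add: is_delta0_def)
  moreover have "wedge L a b \<in> cochains0 L"
    unfolding cochains0_def using assms(3,4) by (intro E.span_base) blast
  ultimately show ?thesis unfolding coboundaries1_def by (rule image_eqI[OF sym])
qed

lemma coboundaries1_subspace:
  assumes "hom_lie3_representation L V" "Vector_Spaces.linear (vscale V) (lscale L) T"
  shows "module.subspace (hom_scale L) (coboundaries1 L V T)"
proof -
  interpret D: Vector_Spaces.linear bivector_scale "hom_scale L" "delta0 L V T"
    using delta0_exists[OF assms] by (simp add: is_delta0_def)
  show ?thesis
    unfolding coboundaries1_def cochains0_def
    by (intro D.subspace_image D.vs1.subspace_span)
qed

text \<open>A coset of a subspace absorbs its elements: closure under sums gives one inclusion,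
  closure under differences the other.\<close>

lemma cohomology_class_add_coboundary:
  assumes "hom_lie3_representation L V" "Vector_Spaces.linear (vscale V) (lscale L) T"
    and c: "c \<in> coboundaries1 L V T"
  shows "cohomology_class L V T (f + c) = cohomology_class L V T f"
proof -
  interpret hom_lie3_representation L V by fact
  interpret H: vector_space "hom_scale L" by (rule vector_space_fun_scale[OF vector_space_L])
  note B = coboundaries1_subspace[OF assms(1,2)]
  show ?thesis
  proof (intro equalityI subsetI)
    fix x assume "x \<in> cohomology_class L V T (f + c)"
    then obtain b where "b \<in> coboundaries1 L V T" "x = f + (c + b)"
      by (auto simp: cohomology_class_def add.assoc)
    with H.subspace_add[OF B c] show "x \<in> cohomology_class L V T f"
      by (auto simp: cohomology_class_def)
  next
    fix x assume "x \<in> cohomology_class L V T f"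
    then obtain b where b: "b \<in> coboundaries1 L V T" "x = f + b"
      by (auto simp: cohomology_class_def)
    then have "x = (f + c) + (b - c)" by simp
    with H.subspace_diff[OF B b(1) c] show "x \<in> cohomology_class L V T (f + c)"
      unfolding cohomology_class_def by blast
  qed
qed

theorem theorem4p4:
  fixes L :: "('k::field_char_0, 'l::ab_group_add) hom_lie3"
    and V :: "('k, 'l, 'v::ab_group_add) hom_rep"
    and T \<II>\<^sub>1 \<II>\<^sub>2 :: "'v \<Rightarrow> 'l"
  assumes "regular_hom_lie3_algebra L"
    and "regular_hom_lie3_representation L V"
    and "embedding_tensor L V T"
    and "linear_deformation L V T \<II>\<^sub>1"
    and "linear_deformation L V T \<II>\<^sub>2"
    and "equivalent_deformations L V (deform L T \<II>\<^sub>1) (deform L T \<II>\<^sub>2)"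
  shows "cohomology_class L V T \<II>\<^sub>1 \<in> cohomology1 L V T
       \<and> cohomology_class L V T \<II>\<^sub>2 \<in> cohomology1 L V T
       \<and> cohomology_class L V T \<II>\<^sub>1 = cohomology_class L V T \<II>\<^sub>2"
proof -
  have rep: "hom_lie3_representation L V"
    using assms(2) by (simp add: regular_hom_lie3_representation_def)
  have T_lin: "Vector_Spaces.linear (vscale V) (lscale L) T"
    using assms(3) by (simp add: embedding_tensor_def)
  have I1_lin: "Vector_Spaces.linear (vscale V) (lscale L) \<II>\<^sub>1"
    using assms(4) by (simp add: linear_deformation_def)
  obtain a b where "twist L a = a" "twist L b = b" and diff: "\<II>\<^sub>2 = \<II>\<^sub>1 + wp L V T a b"
    by (rule equivalent_deformations_diff_wp[OF assms(1-3) I1_lin assms(6)])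
  then have "cohomology_class L V T \<II>\<^sub>1 = cohomology_class L V T \<II>\<^sub>2"
    unfolding diff
    by (intro cohomology_class_add_coboundary[symmetric] wp_coboundary rep T_lin)
  \<comment> \<open>\<open>cohomology_class\<close> accepts any map, so the cocycle property is what
    places both cosets in \<open>cohomology1\<close>.\<close>
  moreover have "\<II>\<^sub>1 \<in> cocycles1 L V T" "\<II>\<^sub>2 \<in> cocycles1 L V T"
    using linear_deformation_cocycle[OF rep assms(3)] assms(4,5) by blast+
  ultimately show ?thesis
    unfolding cohomology1_def by (intro conjI imageI)
qed

end
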